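(* For every positive integer $n$, every orbit of the Lehmer code rotation $\mathcal{L}$ on $S_n$ has size $\mathrm{lcm}(1,2,\dots,n)$.
   Context: For $\sigma\in S_n$ (one-line notation), the Lehmer code is $L(\sigma)=(L(\sigma)_1,\dots,L(\sigma)_n)$ with $L(\sigma)_i=\#\{j>i:\sigma_j<\sigma_i\}\in\{0,\dots,n-i\}$; this is a bijection from $S_n$ to such tuples. The Lehmer code rotation $\mathcal{L}$ sends $\sigma$ to the unique $\tau\in S_n$ with $L(\tau)_i\equiv L(\sigma)_i+1\pmod{n-i+1}$ for all $i$. *)

theory Defs
  imports "HOL-Combinatorics.Permutations" "HOL-Combinatorics.Orbits" "HOL-Number_Theory.Cong"
begin

text \<open>\<open>S\<^sub>n\<close> is the set of all \<open>\<sigma> :: nat \<Rightarrow> nat\<close> with \<open>\<sigma> permutes {1..n}\<close>; the one-line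
  notation of \<open>\<sigma>\<close> is \<open>\<sigma> 1, \<dots>, \<sigma> n\<close>.\<close>

definition lehmer_code :: "nat \<Rightarrow> (nat \<Rightarrow> nat) \<Rightarrow> nat \<Rightarrow> nat" where
  "lehmer_code n \<sigma> i = card {j \<in> {1..n}. i < j \<and> \<sigma> j < \<sigma> i}"

definition lehmer_rotation :: "nat \<Rightarrow> (nat \<Rightarrow> nat) \<Rightarrow> (nat \<Rightarrow> nat)" where
  "lehmer_rotation n \<sigma> =
     (THE \<tau>. \<tau> permutes {1..n} \<and>
        (\<forall>i\<in>{1..n}. [lehmer_code n \<tau> i = lehmer_code n \<sigma> i + 1] (mod (n - i + 1))))"

end

theory Submission
  imports Defs
begin

text \<open>
  In Lehmer code coordinates the rotation adds \<open>1\<close> to every entry, the \<open>i\<close>-th one being read modulo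
  \<open>n - i + 1\<close>. Hence the \<open>k\<close>-th and \<open>m\<close>-th iterates of \<open>\<sigma>\<close> agree iff \<open>k\<close> and \<open>m\<close> are congruent
  modulo each of \<open>1, \<dots>, n\<close>, that is, modulo their least common multiple. Bijectivity of the code
  comes from injectivity and the count \<open>n! = \<Prod>i. (n - i + 1)\<close>.
\<close>

lemma lehmer_code_less:
  assumes "i \<in> {1..n}"
  shows "lehmer_code n \<sigma> i < n - i + 1"
proof -
  have "lehmer_code n \<sigma> i \<le> card {i<..n}"
    unfolding lehmer_code_def by (rule card_mono) auto
  then show ?thesis by simp
qed

text \<open>The values not taken before position \<open>i\<close> are those at positions
  \<open>i..n\<close>, and the strict inequality drops position \<open>i\<close> itself. So the
  entry depends only on \<open>\<sigma> i\<close> and the set of earlier values, which allows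
  decoding from left to right.\<close>

lemma lehmer_code_eq_card_image:
  assumes "\<sigma> permutes {1..n}" "i \<in> {1..n}"
  shows "lehmer_code n \<sigma> i = card {v \<in> {1..n} - \<sigma> ` {1..<i}. v < \<sigma> i}"
proof -
  have inj: "inj \<sigma>" using assms(1) by (rule permutes_inj)
  have "{1..n} - \<sigma> ` {1..<i} = \<sigma> ` ({1..n} - {1..<i})"
    using permutes_image[OF assms(1)] by (simp add: image_set_diff[OF inj])
  also have "{1..n} - {1..<i} = {i..n}" using assms(2) by auto
  finally have "{v \<in> {1..n} - \<sigma> ` {1..<i}. v < \<sigma> i} = \<sigma> ` {j \<in> {1..n}. i < j \<and> \<sigma> j < \<sigma> i}"
    using assms(2) by (force simp: order_le_less)
  then show ?thesis
    unfolding lehmer_code_def using card_image[OF inj_on_subset[OF inj]] by simp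
qed

text \<open>Strong induction on the position: if both permutations agree before \<open>i\<close>,
  the same set \<open>R\<close> of values remains, and the code entry is the rank in
  \<open>R\<close> of the value at \<open>i\<close>.\<close>

lemma lehmer_code_inject:
  assumes s: "\<sigma> permutes {1..n}" and t: "\<tau> permutes {1..n}"
    and eq: "\<And>i. i \<in> {1..n} \<Longrightarrow> lehmer_code n \<sigma> i = lehmer_code n \<tau> i"
  shows "\<sigma> = \<tau>"
proof -
  have "i \<in> {1..n} \<Longrightarrow> \<sigma> i = \<tau> i" for i
  proof (induction i rule: less_induct)
    case (less i)
    define R where "R = {1..n} - \<sigma> ` {1..<i}"
    have "\<sigma> ` {1..<i} = \<tau> ` {1..<i}"
      using less by (intro image_cong) auto
    then have R: "R = {1..n} - \<tau> ` {1..<i}" by (simp add: R_def)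
    have card_eq: "card {v \<in> R. v < \<sigma> i} = card {v \<in> R. v < \<tau> i}"
      using eq[OF less.prems] lehmer_code_eq_card_image[OF s less.prems]
        lehmer_code_eq_card_image[OF t less.prems] 
      by (simp only: R_def[symmetric] R[symmetric])
    have "\<sigma> i \<in> R"
      using less.prems permutes_in_image[OF s, of i] injD[OF permutes_inj[OF s]]
      unfolding R_def by fastforce
    moreover have "\<tau> i \<in> R"
      using less.prems permutes_in_image[OF t, of i] injD[OF permutes_inj[OF t]]
      unfolding R by fastforce
    \<comment> \<open>Ranks in \<open>R\<close> are strictly increasing: \<open>a\<close> itself is
      counted below \<open>b\<close> but not below \<open>a\<close>.\<close>
    moreover have False if "a \<in> R" "a < b" "card {v \<in> R. v < a} = card {v \<in> R. v < b}" for a b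
    proof -
      have "{v \<in> R. v < a} \<subset> {v \<in> R. v < b}" using that by auto
      then have "card {v \<in> R. v < a} < card {v \<in> R. v < b}"
        by (rule psubset_card_mono[rotated]) (simp add: R_def)
      with that show False by simp
    qed
    ultimately show ?case using card_eq by (metis linorder_neqE_nat)
  qed
  then show ?thesis
    using permutes_not_in[OF s] permutes_not_in[OF t] by (metis ext)
qed

text \<open>\<open>restrict\<close> fixes the code outside \<open>{1..n}\<close>, so that codes lie
  in the finite extensional product \<open>PiE\<close>.\<close>

lemma lehmer_code_bij_betw:
  "bij_betw (\<lambda>\<sigma>. restrict (lehmer_code n \<sigma>) {1..n})
     {\<sigma>. \<sigma> permutes {1..n}} (PiE {1..n} (\<lambda>i. {..<n - i + 1}))"
    (is "bij_betw ?L ?P ?C")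
proof -
  have inj: "inj_on ?L ?P"
    by (rule inj_onI) (metis lehmer_code_inject mem_Collect_eq restrict_apply')
  have sub: "?L ` ?P \<subseteq> ?C"
    using lehmer_code_less by (fastforce simp: PiE_iff)
  have "card ?C = (\<Prod>i\<in>{1..n}. n - i + 1)"
    by (simp add: card_PiE)
  also have "\<dots> = \<Prod>{1..n}"
    by (rule prod.reindex_bij_witness[where i = "\<lambda>i. n - i + 1" and j = "\<lambda>i. n - i + 1"]) auto
  also have "\<dots> = card ?P"
    using card_permutations[of "{1..n}" n] by (simp add: fact_prod)
  finally have "card (?L ` ?P) = card ?C"
    using card_image[OF inj] by simp
  then have "?L ` ?P = ?C"
    by (intro card_subset_eq sub) (auto intro: finite_PiE)
  with inj show ?thesis by (simp add: bij_betw_def)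
qed

text \<open>Code entries are already reduced residues, so congruent entries are equal.\<close>

lemma lehmer_code_inject_cong:
  assumes "\<sigma> permutes {1..n}" "\<tau> permutes {1..n}"
    and "\<And>i. i \<in> {1..n} \<Longrightarrow> [lehmer_code n \<sigma> i = lehmer_code n \<tau> i] (mod (n - i + 1))"
  shows "\<sigma> = \<tau>"
  using assms lehmer_code_less by (intro lehmer_code_inject) (blast intro: cong_less_modulus_unique_nat)+

text \<open>Justifies the \<open>THE\<close> in the definition: surjectivity of the code gives
  existence, injectivity gives uniqueness.\<close>

lemma lehmer_rotation:
  shows permutes_lehmer_rotation: "lehmer_rotation n \<sigma> permutes {1..n}"
    and lehmer_code_rotation: "i \<in> {1..n} \<Longrightarrow>
      [lehmer_code n (lehmer_rotation n \<sigma>) i = lehmer_code n \<sigma> i + 1] (mod (n - i + 1))"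
proof -
  let ?Q = "\<lambda>\<tau>. \<tau> permutes {1..n} \<and>
    (\<forall>i\<in>{1..n}. [lehmer_code n \<tau> i = lehmer_code n \<sigma> i + 1] (mod (n - i + 1)))"
  define c where "c = (\<lambda>i\<in>{1..n}. (lehmer_code n \<sigma> i + 1) mod (n - i + 1))"
  have "c \<in> PiE {1..n} (\<lambda>i. {..<n - i + 1})"
    unfolding c_def by (auto simp del: One_nat_def)
  then obtain \<tau> where \<tau>: "\<tau> permutes {1..n}" and c: "c = restrict (lehmer_code n \<tau>) {1..n}"
    using lehmer_code_bij_betw[of n] unfolding bij_betw_def by (metis (lifting) imageE mem_Collect_eq)
  have "lehmer_code n \<tau> i = (lehmer_code n \<sigma> i + 1) mod (n - i + 1)" if "i \<in> {1..n}" for i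
    using fun_cong[OF c, of i] that by (simp add: c_def)
  with \<tau> have "?Q \<tau>" by (simp add: cong_def)
  moreover have "\<rho> = \<tau>" if "?Q \<rho>" for \<rho>
    using that \<open>?Q \<tau>\<close> by (intro lehmer_code_inject_cong) (blast intro: cong_trans cong_sym)+
  ultimately have "?Q (lehmer_rotation n \<sigma>)"
    unfolding lehmer_rotation_def by (rule theI)
  then show "lehmer_rotation n \<sigma> permutes {1..n}"
    and "i \<in> {1..n} \<Longrightarrow>
      [lehmer_code n (lehmer_rotation n \<sigma>) i = lehmer_code n \<sigma> i + 1] (mod (n - i + 1))"
    by blast+
qed

lemma permutes_lehmer_rotation_funpow:
  assumes "\<sigma> permutes {1..n}"
  shows "(lehmer_rotation n ^^ k) \<sigma> permutes {1..n}"
  using assms by (cases k) (simp_all add: permutes_lehmer_rotation del: One_nat_def)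

lemma lehmer_code_rotation_funpow:
  assumes "i \<in> {1..n}"
  shows "[lehmer_code n ((lehmer_rotation n ^^ k) \<sigma>) i = lehmer_code n \<sigma> i + k] (mod (n - i + 1))"
proof (induction k)
  case (Suc k)
  have "[lehmer_code n ((lehmer_rotation n ^^ Suc k) \<sigma>) i
      = lehmer_code n ((lehmer_rotation n ^^ k) \<sigma>) i + 1] (mod (n - i + 1))"
    using lehmer_code_rotation[OF assms] by simp
  also have "[lehmer_code n ((lehmer_rotation n ^^ k) \<sigma>) i + 1
      = lehmer_code n \<sigma> i + k + 1] (mod (n - i + 1))"
    using Suc by (rule cong_add) simp
  finally show ?case by simp
qed simp

text \<open>With the arguments ordered, congruence means that the modulus divides their difference,
  and \<open>Lcm M\<close> divides a number iff every element of \<open>M\<close> does.\<close>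

lemma cong_Lcm_iff_nat:
  fixes a b :: nat
  shows "[a = b] (mod Lcm M) \<longleftrightarrow> (\<forall>m\<in>M. [a = b] (mod m))"
proof (induction a b rule: linorder_wlog)
  case (le a b)
  have "[b = a] (mod Lcm M) \<longleftrightarrow> (\<forall>m\<in>M. [b = a] (mod m))"
    using le by (simp add: cong_altdef_nat Lcm_dvd_iff)
  then show ?case by (simp add: cong_sym_eq)
qed (simp add: cong_sym_eq)

text \<open>The code of \<open>\<sigma>\<close> cancels on both sides, which is why the period is
  the same for every orbit.\<close>

lemma lehmer_rotation_funpow_eq_iff:
  assumes "\<sigma> permutes {1..n}"
  shows "(lehmer_rotation n ^^ k) \<sigma> = (lehmer_rotation n ^^ m) \<sigma> \<longleftrightarrow> [k = m] (mod Lcm {1..n})"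
proof -
  have "(lehmer_rotation n ^^ k) \<sigma> = (lehmer_rotation n ^^ m) \<sigma> \<longleftrightarrow>
      (\<forall>i\<in>{1..n}. [lehmer_code n ((lehmer_rotation n ^^ k) \<sigma>) i
        = lehmer_code n ((lehmer_rotation n ^^ m) \<sigma>) i] (mod (n - i + 1)))"
    using lehmer_code_inject_cong permutes_lehmer_rotation_funpow[OF assms] by (metis cong_refl)
  also have "\<dots> \<longleftrightarrow> (\<forall>i\<in>{1..n}. [lehmer_code n \<sigma> i + k = lehmer_code n \<sigma> i + m] (mod (n - i + 1)))"
    using lehmer_code_rotation_funpow by (intro ball_cong refl) (metis cong_def)
  also have "\<dots> \<longleftrightarrow> (\<forall>i\<in>{1..n}. [k = m] (mod (n - i + 1)))"
    by (simp only: cong_add_lcancel_nat)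
  also have "\<dots> \<longleftrightarrow> (\<forall>d\<in>(\<lambda>i. n - i + 1) ` {1..n}. [k = m] (mod d))"
    by blast
  \<comment> \<open>The reversal \<open>i \<mapsto> n - i + 1\<close> is its own inverse on
    \<open>{1..n}\<close>.\<close>
  also have "(\<lambda>i. n - i + 1) ` {1..n} = {1..n}"
    by (rule bij_betw_imp_surj_on, rule bij_betw_byWitness[where f' = "\<lambda>i. n - i + 1"]) auto
  finally show ?thesis by (simp only: cong_Lcm_iff_nat)
qed

theorem theorem4p7:
  fixes n :: nat and \<sigma> :: "nat \<Rightarrow> nat"
  assumes "n \<ge> 1" and "\<sigma> permutes {1..n}"
  shows "card (orbit (lehmer_rotation n) \<sigma>) = Lcm {1..n}"
proof -
  let ?N = "Lcm {1..n}" and ?f = "\<lambda>k. (lehmer_rotation n ^^ k) \<sigma>"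
  note iff = lehmer_rotation_funpow_eq_iff[OF assms(2)]
  have N: "?N > 0" by (intro Nat.gr0I) (simp add: Lcm_0_iff)
  have "inj_on ?f {..<?N}"
    by (rule inj_onI) (simp add: iff cong_less_modulus_unique_nat del: One_nat_def)
  moreover have "orbit (lehmer_rotation n) \<sigma> = ?f ` {..<?N}"
  proof (intro equalityI subsetI)
    fix \<tau> assume "\<tau> \<in> orbit (lehmer_rotation n) \<sigma>"
    then obtain k where "\<tau> = ?f k" by (auto simp: orbit_altdef)
    then have "\<tau> = ?f (k mod ?N)" by (simp add: iff cong_def)
    then show "\<tau> \<in> ?f ` {..<?N}" by (rule image_eqI) (use N in simp)
  next
    fix \<tau> assume "\<tau> \<in> ?f ` {..<?N}"
    then obtain k where "\<tau> = ?f k" by blast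
    \<comment> \<open>\<open>orbit\<close> collects only iterates with positive exponent, so
      \<open>k = 0\<close> has to be shifted by a full period.\<close>
    then have "\<tau> = ?f (k + ?N)" by (simp add: iff cong_def)
    moreover have "0 < k + ?N" using N by simp
    ultimately show "\<tau> \<in> orbit (lehmer_rotation n) \<sigma>" unfolding orbit_altdef by blast
  qed
  ultimately show ?thesis by (simp add: card_image)
qed

end
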